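(* Let $\mathcal{H},\mathcal{E},\mathcal{K}$ be complex separable Hilbert spaces, $T:\mathcal{H}\to\mathcal{E}$ a bounded linear operator with closed range, $V:\mathcal{H}\to\mathcal{K}$ a surjective bounded linear operator, $b\in\mathcal{K}$, and let $\tilde{x}\in\mathcal{H}$ be such that $V\tilde{x}=b$. Then $\mathrm{sp}(T,V,b)$ is not empty if and only if $\tilde{x}\in\operatorname{dom}P_{T^*T,\ker V}$. If $\tilde{x}\in\operatorname{dom}P_{T^*T,\ker V}$, then $$\mathrm{sp}(T,V,b)=(I-P_{T^*T,\ker V})\tilde{x}.$$
   Context: The set of $(T,V)$-abstract splines to $b$ is $\mathrm{sp}(T,V,b)=\{y\in\mathcal{H}:Vy=b,\ \|Ty\|=\min_{Vx=b}\|Tx\|\}$. A linear relation in $\mathcal{H}$ is a linear subspace $R$ of $\mathcal{H}\times\mathcal{H}$; $\operatorname{dom}R$ is its domain, $Rx=\{y:(x,y)\in R\}$, and $I-R=\{(x,x-y):(x,y)\in R\}$. For a bounded selfadjoint operator $W$ on $\mathcal{H}$ and a subspace $\mathcal{S}$, $P_{W,\mathcal{S}}:=\{(s+n,s):s\in\mathcal{S},\ n\in(W\mathcal{S})^\perp\}$, where $(W\mathcal{S})^\perp=\{x:\langle Wx,s\rangle=0\ \forall s\in\mathcal{S}\}$. Here $W=T^*T$ and $\mathcal{S}=\ker V$. *)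

theory Defs
  imports "HOL-Analysis.Analysis"
begin

text \<open>
  Complex Hilbert spaces are not in the distribution. The class below puts a complex scalar
  multiplication and a complex inner product on a real normed space, compatibly with the
  existing real scalar multiplication and norm. The inner product is linear in its first argument.
\<close>

class complex_inner = real_normed_vector +
  fixes scaleC :: "complex \<Rightarrow> 'a \<Rightarrow> 'a" (infixr "*\<^sub>C" 75)
    and cinner :: "'a \<Rightarrow> 'a \<Rightarrow> complex"
  assumes scaleC_add_right: "c *\<^sub>C (x + y) = c *\<^sub>C x + c *\<^sub>C y"
    and scaleC_add_left: "(c + d) *\<^sub>C x = c *\<^sub>C x + d *\<^sub>C x"
    and scaleC_scaleC: "c *\<^sub>C d *\<^sub>C x = (c * d) *\<^sub>C x"
    and scaleR_scaleC: "r *\<^sub>R x = complex_of_real r *\<^sub>C x"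
    and cinner_commute: "cinner x y = cnj (cinner y x)"
    and cinner_add_left: "cinner (x + y) z = cinner x z + cinner y z"
    and cinner_scaleC_left: "cinner (c *\<^sub>C x) y = c * cinner x y"
    and cinner_nonneg: "0 \<le> Re (cinner x x)"
    and cinner_eq_zero_iff: "cinner x x = 0 \<longleftrightarrow> x = 0"
    and norm_eq_sqrt_cinner: "norm x = sqrt (Re (cinner x x))"

class complex_hilbert_space = complex_inner + complete_space

instantiation complex :: complex_hilbert_space
begin

definition scaleC_complex :: "complex \<Rightarrow> complex \<Rightarrow> complex"
  where "scaleC_complex c x = c * x"

definition cinner_complex :: "complex \<Rightarrow> complex \<Rightarrow> complex"
  where "cinner_complex x y = x * cnj y"

instance
proof
  fix c d x y z :: complex and r :: real
  show "c *\<^sub>C (x + y) = c *\<^sub>C x + c *\<^sub>C y" "(c + d) *\<^sub>C x = c *\<^sub>C x + d *\<^sub>C x"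
    "c *\<^sub>C d *\<^sub>C x = (c * d) *\<^sub>C x"
    by (simp_all add: scaleC_complex_def algebra_simps)
  show "r *\<^sub>R x = complex_of_real r *\<^sub>C x"
    by (simp add: scaleC_complex_def scaleR_conv_of_real)
  show "cinner x y = cnj (cinner y x)" "cinner (x + y) z = cinner x z + cinner y z"
    "cinner (c *\<^sub>C x) y = c * cinner x y" "cinner x x = 0 \<longleftrightarrow> x = 0"
    by (simp_all add: cinner_complex_def scaleC_complex_def algebra_simps)
  show "0 \<le> Re (cinner x x)"
    by (simp add: cinner_complex_def)
  show "norm x = sqrt (Re (cinner x x))"
    by (simp add: cinner_complex_def cmod_def power2_eq_square)
qed

end

definition bounded_clinear ::
    "('a::complex_inner \<Rightarrow> 'b::complex_inner) \<Rightarrow> bool"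
  where "bounded_clinear f \<longleftrightarrow> bounded_linear f \<and> (\<forall>c x. f (c *\<^sub>C x) = c *\<^sub>C f x)"

text \<open>Meaningful for bounded operators between Hilbert spaces, where the adjoint exists and is unique.\<close>

definition cadjoint ::
    "('a::complex_inner \<Rightarrow> 'b::complex_inner) \<Rightarrow> 'b \<Rightarrow> 'a"
  where "cadjoint f = (SOME g. \<forall>x y. cinner (f x) y = cinner x (g y))"

definition ker :: "('a \<Rightarrow> 'b::zero) \<Rightarrow> 'a set"
  where "ker f = {x. f x = 0}"

text \<open>
  A linear relation is represented by its graph, so that its domain is \<open>Domain R\<close> and
  \<open>R x\<close> is \<open>R `` {x}\<close>.
\<close>

definition linear_relation :: "('a::complex_inner \<times> 'a) set \<Rightarrow> bool"
  where "linear_relation R \<longleftrightarrow>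
    (0, 0) \<in> R \<and>
    (\<forall>x y u v. (x, y) \<in> R \<longrightarrow> (u, v) \<in> R \<longrightarrow> (x + u, y + v) \<in> R) \<and>
    (\<forall>c x y. (x, y) \<in> R \<longrightarrow> (c *\<^sub>C x, c *\<^sub>C y) \<in> R)"

definition id_minus :: "('a::ab_group_add \<times> 'a) set \<Rightarrow> ('a \<times> 'a) set"
  where "id_minus R = {(x, x - y) | x y. (x, y) \<in> R}"

text \<open>Here \<open>n\<close> ranges over \<open>(W S)\<^sup>\<bottom>\<close>, for selfadjoint \<open>W\<close>.\<close>

definition proj_relation ::
    "('a::complex_inner \<Rightarrow> 'a) \<Rightarrow> 'a set \<Rightarrow> ('a \<times> 'a) set"
  where "proj_relation W S =
    {(s + n, s) | s n. s \<in> S \<and> n \<in> {x. \<forall>u\<in>S. cinner (W x) u = 0}}"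

text \<open>The last conjunct says that \<open>norm (T y)\<close> is the minimum, attained at \<open>y\<close>.\<close>

definition abstract_splines ::
    "('h::complex_inner \<Rightarrow> 'e::complex_inner) \<Rightarrow> ('h \<Rightarrow> 'k::complex_inner) \<Rightarrow> 'k \<Rightarrow> 'h set"
  where "abstract_splines T V b =
    {y. V y = b \<and> (\<forall>x. V x = b \<longrightarrow> norm (T y) \<le> norm (T x))}"

lemma scaleC_zero_right: "c *\<^sub>C (0::'a::complex_inner) = 0"
  using scaleC_add_right[of c 0 "0::'a"] by simp

lemma linear_relation_proj_relation:
  fixes W :: "'a::complex_inner \<Rightarrow> 'a"
  assumes W: "bounded_clinear W"
    and S: "0 \<in> S" "\<And>x y. x \<in> S \<Longrightarrow> y \<in> S \<Longrightarrow> x + y \<in> S"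
      "\<And>c x. x \<in> S \<Longrightarrow> c *\<^sub>C x \<in> S"
  shows "linear_relation (proj_relation W S)"
proof -
  have bl: "bounded_linear W" and lin_scale: "W (c *\<^sub>C x) = c *\<^sub>C W x" for c x
    using W by (simp_all add: bounded_clinear_def)
  note lin = linear_0[OF bounded_linear.linear[OF bl]] linear_add[OF bounded_linear.linear[OF bl]]
    lin_scale
  have z: "cinner 0 u = 0" for u :: 'a
    using cinner_add_left[of 0 0 u] by simp
  have iff: "(x, s) \<in> proj_relation W S \<longleftrightarrow> s \<in> S \<and> (\<forall>u\<in>S. cinner (W (x - s)) u = 0)" for x s
  proof
    assume "(x, s) \<in> proj_relation W S"
    then show "s \<in> S \<and> (\<forall>u\<in>S. cinner (W (x - s)) u = 0)"
      unfolding proj_relation_def by auto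
  next
    assume *: "s \<in> S \<and> (\<forall>u\<in>S. cinner (W (x - s)) u = 0)"
    have "x = s + (x - s)"
      by simp
    with * show "(x, s) \<in> proj_relation W S"
      unfolding proj_relation_def by blast
  qed
  have d: "(x + u) - (y + v) = (x - y) + (u - v)" for x y u v :: 'a
    by simp
  have e: "c *\<^sub>C x - c *\<^sub>C y = c *\<^sub>C (x - y)" for c and x y :: 'a
    using scaleC_add_right[of c "x - y" y] by simp
  show ?thesis
    unfolding linear_relation_def iff d e
    using S by (auto simp: lin z cinner_add_left cinner_scaleC_left)
qed

end

theory Submission
  imports Defs
begin

text \<open>
  A point \<open>y\<close> with \<open>V y = b\<close> minimises \<open>norm (T y)\<close> over the affine set \<open>y + ker V\<close> exactly when
  \<open>T y\<close> is orthogonal to \<open>T (ker V)\<close>, that is, when \<open>y \<in> (T\<^sup>* T (ker V))\<^sup>\<bottom>\<close>. Writing the given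
  preimage \<open>x\<close> of \<open>b\<close> as \<open>x = (x - y) + y\<close> with \<open>x - y \<in> ker V\<close>, this says that \<open>(x, x - y)\<close> lies in
  \<open>P\<close>, that is, \<open>y \<in> (I - P) x\<close>. The existence of the adjoint rests on the Riesz representation
  theorem, proved by minimising the functional \<open>(norm x)\<^sup>2 - 2 f x\<close>.
\<close>

lemma cinner_add_right: "cinner x (y + z) = cinner x y + cinner (x::'a::complex_inner) z"
  by (metis cinner_add_left cinner_commute complex_cnj_add)

lemma cinner_scaleC_right: "cinner x (c *\<^sub>C y) = cnj c * cinner (x::'a::complex_inner) y"
  by (metis cinner_commute cinner_scaleC_left complex_cnj_mult)

lemma cinner_scaleR_right: "cinner x (r *\<^sub>R y) = of_real r * cinner (x::'a::complex_inner) y"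
  by (simp add: scaleR_scaleC cinner_scaleC_right)

lemma Re_cinner_commute: "Re (cinner x y) = Re (cinner y (x::'a::complex_inner))"
  by (subst cinner_commute) simp

lemma power2_norm_eq_cinner: "(norm (x::'a::complex_inner))\<^sup>2 = Re (cinner x x)"
  by (simp add: norm_eq_sqrt_cinner cinner_nonneg)

lemma power2_norm_add:
  "(norm (x + y))\<^sup>2 = (norm (x::'a::complex_inner))\<^sup>2 + 2 * Re (cinner x y) + (norm y)\<^sup>2"
  using Re_cinner_commute[of x y]
  by (simp add: power2_norm_eq_cinner cinner_add_left cinner_add_right)

text \<open>The midpoint form is chosen because a minimum bounds the value at the midpoint from
  below, which forces near-minimisers to be close.\<close>

lemma parallelogram_midpoint:
  fixes x y :: "'a::complex_inner"
  shows "(norm (x - y))\<^sup>2 = 2 * (norm x)\<^sup>2 + 2 * (norm y)\<^sup>2 - 4 * (norm ((1/2) *\<^sub>R (x + y)))\<^sup>2"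
  using power2_norm_add[of x y] power2_norm_add[of x "(-1) *\<^sub>R y"]
  by (simp only: cinner_scaleR_right) (simp add: power_mult_distrib power_divide add_divide_distrib)

text \<open>The factor 1 compares real parts and the factor i imaginary parts. This lifts identities
  between real parts of inner products to complex ones.\<close>

lemma complex_eqI_Re_mult:
  assumes "\<And>c. Re (c * w) = Re (c * z)"
  shows "w = z"
  using assms[of 1] assms[of \<i>] by (simp add: complex_eq_iff)

text \<open>First variation: for small \<open>t\<close> of suitable sign a nonzero linear term would
  outweigh the quadratic one.\<close>

lemma nonneg_quadratic_imp_linear_coeff_zero:
  fixes a b :: real
  assumes "0 \<le> a" and "\<And>t. 0 \<le> t\<^sup>2 * a + 2 * t * b"
  shows "b = 0"
proof (rule ccontr)
  assume "b \<noteq> 0"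
  \<comment> \<open>The minimiser would be \<open>- b / a\<close>; the shifted denominator also
    covers \<open>a = 0\<close>.\<close>
  have "(- b / (a + 1))\<^sup>2 * a + 2 * (- b / (a + 1)) * b = - (b\<^sup>2 * (a + 2)) / (a + 1)\<^sup>2"
    using assms(1) by (simp add: divide_simps power2_eq_square) (simp add: algebra_simps)
  also have "\<dots> < 0"
    using assms(1) \<open>b \<noteq> 0\<close> by (simp add: divide_neg_pos)
  finally show False
    using assms(2)[of "- b / (a + 1)"] by simp
qed

lemma riesz_representation_Re:
  fixes f :: "'a::complex_hilbert_space \<Rightarrow> real"
  assumes "bounded_linear f"
  shows "\<exists>z. \<forall>x. f x = Re (cinner x z)"
proof -
  interpret f: bounded_linear f by fact
  \<comment> \<open>If \<open>z\<close> represents \<open>f\<close>, then \<open>J x\<close> is the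
    squared distance from \<open>x\<close> to \<open>z\<close> minus
    \<open>(norm z)\<^sup>2\<close>, so a minimiser of \<open>J\<close> is the vector
    sought.\<close>
  define J where "J x = (norm x)\<^sup>2 - 2 * f x" for x
  define m where "m = Inf (range J)"
  obtain C where C: "\<And>x. norm (f x) \<le> norm x * C"
    using f.bounded by blast
  have "- C\<^sup>2 \<le> J x" for x
    using C[of x] zero_le_power2[of "norm x - C"]
    by (simp add: J_def power2_diff algebra_simps)
  then have bdd: "bdd_below (range J)"
    by (rule bdd_belowI2)
  then have m_le: "m \<le> J x" for x
    unfolding m_def by (auto intro: cInf_lower)
  have "\<exists>x. J x < m + 1 / Suc n" for n
    using bdd cInf_less_iff[of "range J" "m + 1 / Suc n"] by (auto simp: m_def)
  then obtain X where X: "\<And>n. J (X n) < m + 1 / Suc n"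
    by metis
  \<comment> \<open>The linear part of \<open>J\<close> cancels here, so the parallelogram law
    survives for \<open>J\<close>.\<close>
  have J_mid: "(norm (x - y))\<^sup>2 = 2 * J x + 2 * J y - 4 * J ((1/2) *\<^sub>R (x + y))" for x y
    unfolding J_def parallelogram_midpoint[of x y] by (simp add: f.add f.scaleR add_divide_distrib)
  have "Cauchy X"
  proof (rule metric_CauchyI)
    fix e :: real assume "0 < e"
    \<comment> \<open>Two values of \<open>J\<close> below \<open>m + e\<^sup>2 / 4\<close> and a
      midpoint value of at least \<open>m\<close> give a squared distance below
      \<open>e\<^sup>2\<close> by \<open>J_mid\<close>.\<close>
    then obtain N where N: "1 / real (Suc N) < e\<^sup>2 / 4"
      using nat_approx_posE[of "e\<^sup>2 / 4"] by auto
    have close: "J (X n) < m + e\<^sup>2 / 4" if "N \<le> n" for n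
    proof -
      have "1 / real (Suc n) \<le> 1 / real (Suc N)"
        using that by (simp add: frac_le)
      then show ?thesis
        using X[of n] N by linarith
    qed
    have "dist (X k) (X n) < e" if "N \<le> k" "N \<le> n" for k n
    proof -
      have "(norm (X k - X n))\<^sup>2 < e\<^sup>2"
        using J_mid[of "X k" "X n"] m_le[of "(1/2) *\<^sub>R (X k + X n)"] close[OF that(1)]
          close[OF that(2)] by linarith
      then show ?thesis
        using \<open>0 < e\<close> by (simp add: dist_norm power_less_imp_less_base)
    qed
    then show "\<exists>M. \<forall>k\<ge>M. \<forall>n\<ge>M. dist (X k) (X n) < e"
      by blast
  qed
  then obtain z where "X \<longlonglongrightarrow> z"
    using Cauchy_convergent convergent_def by blast
  then have "(\<lambda>n. J (X n)) \<longlonglongrightarrow> J z"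
    unfolding J_def by (intro tendsto_intros f.tendsto)
  moreover have "(\<lambda>n. m + 1 / Suc n) \<longlonglongrightarrow> m"
    using tendsto_add[OF tendsto_const LIMSEQ_inverse_real_of_nat, of m]
    by (simp add: inverse_eq_divide)
  ultimately have "J z \<le> m"
    by (rule LIMSEQ_le) (use X less_imp_le in blast)
  have "f x = Re (cinner x z)" for x
  proof -
    have "0 \<le> t\<^sup>2 * (norm x)\<^sup>2 + 2 * t * (Re (cinner z x) - f x)" for t
    proof -
      have "J z \<le> J (z + t *\<^sub>R x)"
        using \<open>J z \<le> m\<close> m_le order_trans by blast
      then show ?thesis
        unfolding J_def power2_norm_add
        by (simp add: f.add f.scaleR cinner_scaleR_right power_mult_distrib algebra_simps)
    qed
    then have "Re (cinner z x) - f x = 0"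
      by (rule nonneg_quadratic_imp_linear_coeff_zero[rotated]) simp
    then show ?thesis
      by (simp add: Re_cinner_commute)
  qed
  then show ?thesis
    by blast
qed

text \<open>The norm already satisfies the triangle inequality; squaring it for \<open>x + y\<close>
  and \<open>x - y\<close> bounds the cross term from both sides.\<close>

lemma cauchy_schwarz_Re:
  "\<bar>Re (cinner x y)\<bar> \<le> norm x * norm (y::'a::complex_inner)"
proof -
  have "(norm (x + y))\<^sup>2 \<le> (norm x + norm y)\<^sup>2" "(norm (x + - 1 *\<^sub>R y))\<^sup>2 \<le> (norm x + norm y)\<^sup>2"
    using norm_triangle_ineq[of x y] norm_triangle_ineq[of x "- 1 *\<^sub>R y"]
    by (auto intro!: power_mono)
  then show ?thesis
    unfolding power2_norm_add cinner_scaleR_right by (simp add: power2_sum)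
qed

lemma bounded_linear_Re_cinner_left:
  "bounded_linear (\<lambda>x. Re (cinner x (y::'a::complex_inner)))"
proof (rule bounded_linear_intro)
  show "norm (Re (cinner x y)) \<le> norm x * norm y" for x
    by (simp add: cauchy_schwarz_Re)
qed (simp_all only: cinner_add_left scaleR_scaleC cinner_scaleC_left, simp_all)

text \<open>For fixed \<open>y\<close>, the Riesz theorem represents the real part of
  \<open>cinner (T x) y\<close>. Replacing \<open>x\<close> by its complex multiples recovers the
  full inner product.\<close>

lemma cadjoint_exists:
  fixes T :: "'h::complex_hilbert_space \<Rightarrow> 'e::complex_inner"
  assumes "bounded_clinear T"
  shows "\<exists>g. \<forall>x y. cinner (T x) y = cinner x (g y)"
proof -
  have T: "bounded_linear T" and T_scaleC: "T (c *\<^sub>C x) = c *\<^sub>C T x" for c x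
    using assms by (auto simp: bounded_clinear_def)
  have "\<exists>z. \<forall>x. cinner (T x) y = cinner x z" for y
  proof -
    have "bounded_linear (\<lambda>x. Re (cinner (T x) y))"
      using bounded_linear_compose[OF bounded_linear_Re_cinner_left T] .
    from riesz_representation_Re[OF this]
    obtain z where z: "\<forall>x. Re (cinner (T x) y) = Re (cinner x z)" ..
    have "cinner (T x) y = cinner x z" for x
    proof (rule complex_eqI_Re_mult)
      show "Re (c * cinner (T x) y) = Re (c * cinner x z)" for c
        using spec[OF z, of "c *\<^sub>C x"] by (simp only: T_scaleC cinner_scaleC_left)
    qed
    then show ?thesis
      by blast
  qed
  then have "\<exists>g. \<forall>y x. cinner (T x) y = cinner x (g y)"
    by (intro choice allI)
  then show ?thesis
    by blast
qed

lemma cinner_cadjoint_right: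
  fixes T :: "'h::complex_hilbert_space \<Rightarrow> 'e::complex_inner"
  assumes "bounded_clinear T"
  shows "cinner x (cadjoint T y) = cinner (T x) y"
  unfolding cadjoint_def using someI_ex[OF cadjoint_exists[OF assms]] by (metis (no_types))

lemma cinner_cadjoint_left:
  fixes T :: "'h::complex_hilbert_space \<Rightarrow> 'e::complex_inner"
  assumes "bounded_clinear T"
  shows "cinner (cadjoint T y) x = cinner y (T x)"
  by (metis assms cinner_cadjoint_right cinner_commute)

lemma mem_abstract_splines_iff:
  fixes T :: "'h::complex_inner \<Rightarrow> 'e::complex_inner" and V :: "'h \<Rightarrow> 'k::complex_inner"
  assumes T: "bounded_clinear T" and V: "bounded_clinear V"
  shows "y \<in> abstract_splines T V b \<longleftrightarrow> V y = b \<and> (\<forall>u\<in>ker V. cinner (T y) (T u) = 0)"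
proof -
  interpret T: bounded_linear T using T by (simp add: bounded_clinear_def)
  interpret V: bounded_linear V using V by (simp add: bounded_clinear_def)
  have T_scaleC: "T (c *\<^sub>C x) = c *\<^sub>C T x" and V_scaleC: "V (c *\<^sub>C x) = c *\<^sub>C V x" for c x
    using T V by (simp_all add: bounded_clinear_def)
  have "cinner (T y) (T u) = 0"
    if min: "\<And>x. V x = V y \<Longrightarrow> norm (T y) \<le> norm (T x)" and u: "u \<in> ker V" for u
  proof (rule complex_eqI_Re_mult)
    fix c
    \<comment> \<open>The inner product is conjugate linear in its second argument, so the conjugate
      makes \<open>Re (cinner (T y) (T v))\<close> equal to
      \<open>Re (c * cinner (T y) (T u))\<close>.\<close>
    define v where "v = cnj c *\<^sub>C u"
    have "0 \<le> t\<^sup>2 * (norm (T v))\<^sup>2 + 2 * t * Re (cinner (T y) (T v))" for t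
    proof -
      have "V (y + t *\<^sub>R v) = V y"
        using u by (simp add: ker_def v_def V.add V.scaleR V_scaleC scaleC_zero_right)
      then have "(norm (T y))\<^sup>2 \<le> (norm (T y + t *\<^sub>R T v))\<^sup>2"
        using min by (metis T.add T.scaleR norm_ge_zero power_mono)
      then show ?thesis
        unfolding power2_norm_add by (simp add: cinner_scaleR_right power_mult_distrib)
    qed
    then have "Re (cinner (T y) (T v)) = 0"
      by (rule nonneg_quadratic_imp_linear_coeff_zero[rotated]) simp
    then show "Re (c * cinner (T y) (T u)) = Re (c * 0)"
      by (simp only: v_def T_scaleC cinner_scaleC_right) simp
  qed
  moreover have "norm (T y) \<le> norm (T x)"
    if orth: "\<And>u. u \<in> ker V \<Longrightarrow> cinner (T y) (T u) = 0" and x: "V x = V y" for x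
  proof -
    have "x - y \<in> ker V"
      using x by (simp add: ker_def V.diff)
    \<comment> \<open>Pythagoras: orthogonality removes the cross term.\<close>
    then have "(norm (T y + T (x - y)))\<^sup>2 = (norm (T y))\<^sup>2 + (norm (T (x - y)))\<^sup>2"
      unfolding power2_norm_add by (simp add: orth)
    then have "(norm (T y))\<^sup>2 \<le> (norm (T x))\<^sup>2"
      by (simp add: T.diff)
    then show ?thesis
      by (rule power2_le_imp_le) simp
  qed
  ultimately show ?thesis
    unfolding abstract_splines_def by auto
qed

text \<open>The summand from the orthogonal complement is forced to be \<open>x - s\<close>, which
  removes the existential quantifiers.\<close>

lemma mem_proj_relation_iff:
  "(x, s) \<in> proj_relation W S \<longleftrightarrow> s \<in> S \<and> (\<forall>u\<in>S. cinner (W (x - s)) u = 0)"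
proof
  assume "s \<in> S \<and> (\<forall>u\<in>S. cinner (W (x - s)) u = 0)"
  moreover have "x = s + (x - s)"
    by simp
  ultimately show "(x, s) \<in> proj_relation W S"
    unfolding proj_relation_def by blast
qed (auto simp: proj_relation_def)

theorem proposition5p8:
  fixes T :: "'h::complex_hilbert_space \<Rightarrow> 'e::complex_hilbert_space"
    and V :: "'h \<Rightarrow> 'k::complex_hilbert_space"
    and b :: 'k
    and xt :: 'h
  assumes "separable_space (euclidean :: 'h topology)"
    and "separable_space (euclidean :: 'e topology)"
    and "separable_space (euclidean :: 'k topology)"
    and "bounded_clinear T" and "closed (range T)"
    and "bounded_clinear V" and "surj V"
    and "V xt = b"
  shows "(abstract_splines T V b \<noteq> {} \<longleftrightarrow>
            xt \<in> Domain (proj_relation (cadjoint T \<circ> T) (ker V))) \<and>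
         (xt \<in> Domain (proj_relation (cadjoint T \<circ> T) (ker V)) \<longrightarrow>
            abstract_splines T V b = id_minus (proj_relation (cadjoint T \<circ> T) (ker V)) `` {xt})"
proof -
  let ?P = "proj_relation (cadjoint T \<circ> T) (ker V)"
  interpret V: bounded_linear V using \<open>bounded_clinear V\<close> by (simp add: bounded_clinear_def)
  \<comment> \<open>Since \<open>V xt = b\<close>, the condition \<open>V y = b\<close> says that
    \<open>xt - y\<close> is in \<open>ker V\<close>. The remaining summand is
    \<open>xt - (xt - y) = y\<close>, and the adjoint turns its orthogonality condition into that of
    \<open>T y\<close> to \<open>T (ker V)\<close>.\<close>
  have "y \<in> abstract_splines T V b \<longleftrightarrow> (xt, xt - y) \<in> ?P" for y
    using \<open>V xt = b\<close> \<open>bounded_clinear T\<close> \<open>bounded_clinear V\<close>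
    by (auto simp: mem_abstract_splines_iff mem_proj_relation_iff cinner_cadjoint_left
        ker_def V.diff)
  moreover have "y \<in> id_minus ?P `` {xt} \<longleftrightarrow> (xt, xt - y) \<in> ?P" for y
  proof
    assume "(xt, xt - y) \<in> ?P"
    then have "(xt, xt - (xt - y)) \<in> id_minus ?P"
      unfolding id_minus_def by blast
    then show "y \<in> id_minus ?P `` {xt}"
      by simp
  qed (auto simp: id_minus_def)
  ultimately have "abstract_splines T V b = id_minus ?P `` {xt}"
    by blast
  \<comment> \<open>\<open>id_minus\<close> preserves the domain, so the existence claim can be read
    off from the set equality.\<close>
  moreover have "id_minus ?P `` {xt} \<noteq> {} \<longleftrightarrow> xt \<in> Domain ?P"
    by (auto simp: id_minus_def)
  ultimately show ?thesis
    by simp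
qed

end
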